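(* Let $f$ be as in the context. The sequences $\{x_k\}_{k=0}^\infty$, $\{\phi_k(x)\}_{k=0}^\infty$ and $\{\alpha_k\}_{k=0}^\infty$ generated by the algorithm SUESA (described in the context), from any initial point $x_0\in\mathbb{R}^n$, form an Underestimate Sequence (UES) of $f$, so SUESA converges at a linear rate: for all $k\ge0$, $$f(x_k)-\phi_k^*\le\left(1-\tfrac{\mu}{L}\right)^k(f(x_0)-\phi_0^* ).$$
   Context: Setting (smooth case): $f:\mathbb{R}^n\to\mathbb{R}$ is continuously differentiable, $\mu$-strongly convex and $L$-smooth with $L>\mu>0$, i.e. for all $x,y\in\mathbb{R}^n$ (Euclidean norm): $f(x)\ge f(y)+\langle\nabla f(y),x-y\rangle+\frac{\mu}{2}\|x-y\|^2$ and $f(x)\le f(y)+\langle\nabla f(y),x-y\rangle+\frac{L}{2}\|x-y\|^2$. For a point $y$: $y^{++}:=y-\frac1\mu\nabla f(y)$. For $x,y\in\mathbb{R}^n$ put $\phi(x;y):=f(y)-\frac{1}{2\mu}\|\nabla f(y)\|^2+\frac{\mu}{2}\|x-y^{++}\|^2$. Algorithm SUESA (run without its stopping test, so that infinite sequences are produced): given $x_0$, set $\alpha_k=\mu/L$ for all $k\ge0$ and $\phi_0(x):=\phi(x;x_0)$. For $k=0,1,2,\dots$: set $y_k=x_k$; $x_{k+1}=x_k-\frac1L\nabla f(x_k)$; $\phi_{k+1}(x):=(1-\alpha_k)\phi_k(x)+\alpha_k\phi(x;y_k)$. Throughout, $\phi_k^*:=\min_x\phi_k(x)$. Definition (UES).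 A series of sequences $\{x_k\}_{k=0}^\infty\subset\mathbb{R}^n$, $\{\phi_k(x)\}_{k=0}^\infty$ (real-valued functions on $\mathbb{R}^n$, each attaining its minimum) and $\{\alpha_k\}_{k=0}^\infty$ with $\alpha_k\in(0,1)$ for all $k\ge0$ is called an Underestimate Sequence (UES) of a function $F:\mathbb{R}^n\to\mathbb{R}$ if for all $x\in\mathbb{R}^n$ and all $k\ge0$: (i) $\phi_k(x)\le F(x)$; and (ii) $F(x_{k+1})-\phi_{k+1}^*\le(1-\alpha_k)(F(x_k)-\phi_k^* )$, where $\phi_k^*:=\min_x\phi_k(x)$. Here $F=f$. *)

theory Defs
  imports "HOL-Analysis.Analysis"
begin

definition grad :: "(real ^ 'n \<Rightarrow> real) \<Rightarrow> real ^ 'n \<Rightarrow> real ^ 'n" where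
  "grad f x = (THE g. GDERIV f x :> g)"

lemma grad_eqI:
  assumes "GDERIV f x :> g"
  shows "grad f x = g"
proof -
  have "h = g" if "GDERIV f x :> h" for h
  proof -
    have "(\<lambda>v. v \<bullet> h) = (\<lambda>v. v \<bullet> g)"
      using has_derivative_unique that assms unfolding gderiv_def by blast
    then show ?thesis
      by (metis vector_eq_ldot)
  qed
  with assms show ?thesis
    unfolding grad_def by blast
qed

definition continuously_differentiable :: "(real ^ 'n \<Rightarrow> real) \<Rightarrow> bool" where
  "continuously_differentiable f \<longleftrightarrow>
     (\<forall>x. GDERIV f x :> grad f x) \<and> continuous_on UNIV (grad f)"

definition strongly_convex :: "real \<Rightarrow> (real ^ 'n \<Rightarrow> real) \<Rightarrow> bool" where
  "strongly_convex \<mu> f \<longleftrightarrow>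
     (\<forall>x y. f x \<ge> f y + grad f y \<bullet> (x - y) + \<mu> / 2 * (norm (x - y))\<^sup>2)"

definition L_smooth :: "real \<Rightarrow> (real ^ 'n \<Rightarrow> real) \<Rightarrow> bool" where
  "L_smooth L f \<longleftrightarrow>
     (\<forall>x y. f x \<le> f y + grad f y \<bullet> (x - y) + L / 2 * (norm (x - y))\<^sup>2)"

definition attains_min :: "(real ^ 'n \<Rightarrow> real) \<Rightarrow> bool" where
  "attains_min h \<longleftrightarrow> (\<exists>z. \<forall>x. h z \<le> h x)"

text \<open>The following value is meaningful only for functions satisfying \<^const>\<open>attains_min\<close>.\<close>

definition min_value :: "(real ^ 'n \<Rightarrow> real) \<Rightarrow> real" where
  "min_value h = (LEAST v. v \<in> range h)"

lemma min_value_eqI: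
  assumes "\<And>x. h z \<le> h x"
  shows "min_value h = h z"
  unfolding min_value_def using assms by (intro Least_equality) auto

definition underestimate_sequence ::
  "(real ^ 'n \<Rightarrow> real) \<Rightarrow> (nat \<Rightarrow> real ^ 'n) \<Rightarrow> (nat \<Rightarrow> real ^ 'n \<Rightarrow> real) \<Rightarrow> (nat \<Rightarrow> real) \<Rightarrow> bool" where
  "underestimate_sequence F x \<phi> \<alpha> \<longleftrightarrow>
     (\<forall>k. attains_min (\<phi> k)) \<and>
     (\<forall>k. 0 < \<alpha> k \<and> \<alpha> k < 1) \<and>
     (\<forall>k z. \<phi> k z \<le> F z) \<and>
     (\<forall>k. F (x (Suc k)) - min_value (\<phi> (Suc k)) \<le> (1 - \<alpha> k) * (F (x k) - min_value (\<phi> k)))"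

definition long_step :: "real \<Rightarrow> (real ^ 'n \<Rightarrow> real) \<Rightarrow> real ^ 'n \<Rightarrow> real ^ 'n" where
  "long_step \<mu> f y = y - (1 / \<mu>) *\<^sub>R grad f y"

definition lower_model :: "real \<Rightarrow> (real ^ 'n \<Rightarrow> real) \<Rightarrow> real ^ 'n \<Rightarrow> real ^ 'n \<Rightarrow> real" where
  "lower_model \<mu> f y x =
     f y - 1 / (2 * \<mu>) * (norm (grad f y))\<^sup>2 + \<mu> / 2 * (norm (x - long_step \<mu> f y))\<^sup>2"

definition suesa_alpha :: "real \<Rightarrow> real \<Rightarrow> nat \<Rightarrow> real" where
  "suesa_alpha \<mu> L k = \<mu> / L"

primrec suesa_x :: "real \<Rightarrow> (real ^ 'n \<Rightarrow> real) \<Rightarrow> real ^ 'n \<Rightarrow> nat \<Rightarrow> real ^ 'n" where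
  "suesa_x L f x0 0 = x0"
| "suesa_x L f x0 (Suc k) = suesa_x L f x0 k - (1 / L) *\<^sub>R grad f (suesa_x L f x0 k)"

definition suesa_y :: "real \<Rightarrow> (real ^ 'n \<Rightarrow> real) \<Rightarrow> real ^ 'n \<Rightarrow> nat \<Rightarrow> real ^ 'n" where
  "suesa_y L f x0 k = suesa_x L f x0 k"

primrec suesa_phi ::
  "real \<Rightarrow> real \<Rightarrow> (real ^ 'n \<Rightarrow> real) \<Rightarrow> real ^ 'n \<Rightarrow> nat \<Rightarrow> real ^ 'n \<Rightarrow> real" where
  "suesa_phi \<mu> L f x0 0 = lower_model \<mu> f x0"
| "suesa_phi \<mu> L f x0 (Suc k) =
     (\<lambda>x. (1 - suesa_alpha \<mu> L k) * suesa_phi \<mu> L f x0 k x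
        + suesa_alpha \<mu> L k * lower_model \<mu> f (suesa_y L f x0 k) x)"

end

theory Submission
  imports Defs
begin

text \<open>
  Every \<open>\<phi>\<^sub>k\<close> is a convex combination of the lower models built so far, and these are quadratics
  \<open>m + \<mu>/2 \<parallel>x - v\<parallel>\<^sup>2\<close> with the same curvature \<open>\<mu>\<close>. Such quadratics are closed under
  convex combinations, so each \<open>\<phi>\<^sub>k\<close> attains its minimum. The minimum of a convex combination
  is at least the convex combination of the minima, so an update of weight \<open>\<mu>/L\<close> raises the lower
  bound to
  \<open>\<phi>\<^sub>k\<^sub>+\<^sub>1\<^sup>* \<ge> (1 - \<mu>/L) \<phi>\<^sub>k\<^sup>* + \<mu>/L (f(x\<^sub>k) - \<parallel>\<nabla>f(x\<^sub>k)\<parallel>\<^sup>2 / (2 \<mu>))\<close>,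
  while the gradient step of length \<open>1/L\<close> gives
  \<open>f(x\<^sub>k\<^sub>+\<^sub>1) \<le> f(x\<^sub>k) - \<parallel>\<nabla>f(x\<^sub>k)\<parallel>\<^sup>2 / (2 L)\<close>. The weight \<open>\<mu>/L\<close> is exactly the one
  for which the two gradient terms cancel on subtraction, which leaves the gap contracted by
  \<open>1 - \<mu>/L\<close>. That \<open>\<phi>\<^sub>k \<le> f\<close> is strong convexity with the square completed
  (\<open>lower_model_le\<close>), a bound inherited by convex combinations.
\<close>

lemma quadratic_attains_min:
  fixes v :: "real ^ 'n"
  assumes "0 \<le> \<mu>"
  shows "attains_min (\<lambda>x. m + \<mu> / 2 * (norm (x - v))\<^sup>2)"
  unfolding attains_min_def using assms by (intro exI[of _ v]) simp

lemma min_value_quadratic: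
  fixes v :: "real ^ 'n"
  assumes "0 \<le> \<mu>"
  shows "min_value (\<lambda>x. m + \<mu> / 2 * (norm (x - v))\<^sup>2) = m"
  using min_value_eqI[of "\<lambda>x. m + \<mu> / 2 * (norm (x - v))\<^sup>2" v] assms by simp

lemma min_value_lower_model:
  assumes "0 \<le> \<mu>"
  shows "min_value (lower_model \<mu> f y) = f y - 1 / (2 * \<mu>) * (norm (grad f y))\<^sup>2"
  unfolding lower_model_def[abs_def] by (rule min_value_quadratic[OF assms])

text \<open>
  This is the variance decomposition for a two-point distribution: the mean squared distance from
  \<open>x\<close> is the squared distance to the mean plus the variance.
\<close>

lemma convex_combination_norm_square:
  fixes x v w :: "'a::real_inner"
  shows "(1 - a) * (norm (x - v))\<^sup>2 + a * (norm (x - w))\<^sup>2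
    = (norm (x - ((1 - a) *\<^sub>R v + a *\<^sub>R w)))\<^sup>2 + a * (1 - a) * (norm (v - w))\<^sup>2"
  by (simp add: power2_norm_eq_inner inner_commute algebra_simps)

lemma convex_combination_quadratic:
  fixes x v w :: "'a::real_inner"
  shows "(1 - a) * (m + c * (norm (x - v))\<^sup>2) + a * (p + c * (norm (x - w))\<^sup>2)
    = ((1 - a) * m + a * p + c * (a * (1 - a) * (norm (v - w))\<^sup>2))
      + c * (norm (x - ((1 - a) *\<^sub>R v + a *\<^sub>R w)))\<^sup>2"
proof -
  have "(1 - a) * (m + c * (norm (x - v))\<^sup>2) + a * (p + c * (norm (x - w))\<^sup>2)
    = (1 - a) * m + a * p + c * ((1 - a) * (norm (x - v))\<^sup>2 + a * (norm (x - w))\<^sup>2)"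
    by (simp add: algebra_simps)
  then show ?thesis
    unfolding convex_combination_norm_square by (simp add: algebra_simps)
qed

lemma suesa_phi_quadratic:
  "\<exists>m v. suesa_phi \<mu> L f x0 k = (\<lambda>x. m + \<mu> / 2 * (norm (x - v))\<^sup>2)"
proof (induction k)
  case 0
  show ?case by (auto simp: lower_model_def[abs_def])
next
  case (Suc k)
  then obtain m v where "suesa_phi \<mu> L f x0 k = (\<lambda>x. m + \<mu> / 2 * (norm (x - v))\<^sup>2)"
    by blast
  then show ?case
    by (auto simp only: suesa_phi.simps lower_model_def convex_combination_quadratic)
qed

lemma attains_min_suesa_phi:
  assumes "0 \<le> \<mu>"
  shows "attains_min (suesa_phi \<mu> L f x0 k)"
  using suesa_phi_quadratic[of \<mu> L f x0 k] quadratic_attains_min[OF assms] by metis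

lemma min_value_le:
  assumes "attains_min h"
  shows "min_value h \<le> h x"
  using assms unfolding attains_min_def by (metis min_value_eqI)

lemma min_value_convex_combination:
  assumes "0 \<le> a" "a \<le> 1" "attains_min g" "attains_min h"
    and "attains_min (\<lambda>x. (1 - a) * g x + a * h x)"
  shows "(1 - a) * min_value g + a * min_value h \<le> min_value (\<lambda>x. (1 - a) * g x + a * h x)"
proof -
  obtain z where z: "\<And>x. (1 - a) * g z + a * h z \<le> (1 - a) * g x + a * h x"
    using assms(5) unfolding attains_min_def by blast
  have "(1 - a) * min_value g + a * min_value h \<le> (1 - a) * g z + a * h z"
    using assms by (intro add_mono mult_left_mono min_value_le) auto
  also have "\<dots> = min_value (\<lambda>x. (1 - a) * g x + a * h x)"
    using min_value_eqI[of "\<lambda>x. (1 - a) * g x + a * h x" z] z by simp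
  finally show ?thesis .
qed

text \<open>
  The lower model at \<open>y\<close> is the quadratic minorant \<open>f y + \<nabla>f y \<bullet> (x - y) + \<mu>/2 \<parallel>x - y\<parallel>\<^sup>2\<close> of
  strong convexity, with the square completed around the long step.
\<close>

lemma lower_model_le:
  assumes "\<mu> \<noteq> 0" "strongly_convex \<mu> f"
  shows "lower_model \<mu> f y x \<le> f x"
proof -
  have shift: "x - long_step \<mu> f y = (x - y) + (1 / \<mu>) *\<^sub>R grad f y"
    by (simp add: long_step_def)
  have "\<mu> / 2 * (norm (x - long_step \<mu> f y))\<^sup>2
      = \<mu> / 2 * (norm (x - y))\<^sup>2 + grad f y \<bullet> (x - y) + 1 / (2 * \<mu>) * (norm (grad f y))\<^sup>2"
    unfolding shift power2_norm_eq_inner inner_add_left inner_add_right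
      inner_scaleR_left inner_scaleR_right inner_commute[of "x - y" "grad f y"]
    using assms(1) by (simp add: distrib_left)
  then have "lower_model \<mu> f y x = f y + grad f y \<bullet> (x - y) + \<mu> / 2 * (norm (x - y))\<^sup>2"
    unfolding lower_model_def by linarith
  then show ?thesis
    using assms(2) by (simp add: strongly_convex_def)
qed

lemma suesa_phi_le:
  assumes "0 < \<mu>" "\<mu> \<le> L" "strongly_convex \<mu> f"
  shows "suesa_phi \<mu> L f x0 k x \<le> f x"
proof (induction k)
  case 0
  show ?case using assms lower_model_le[of \<mu> f] by simp
next
  case (Suc k)
  have "(1 - \<mu> / L) * suesa_phi \<mu> L f x0 k x + \<mu> / L * lower_model \<mu> f (suesa_y L f x0 k) x
      \<le> (1 - \<mu> / L) * f x + \<mu> / L * f x"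
    using assms Suc lower_model_le[of \<mu> f] by (intro add_mono mult_left_mono) auto
  then show ?case by (simp add: suesa_alpha_def algebra_simps)
qed

text \<open>
  For \<open>L > 0\<close> the step length \<open>1/L\<close> minimises the quadratic majorant of \<open>L\<close>-smoothness at \<open>y\<close>,
  and the right-hand side is its minimum.
\<close>

lemma gradient_step_descent:
  assumes "L \<noteq> 0" "L_smooth L f"
  shows "f (y - (1 / L) *\<^sub>R grad f y) \<le> f y - 1 / (2 * L) * (norm (grad f y))\<^sup>2"
proof -
  let ?g = "grad f y"
  have "f (y - (1 / L) *\<^sub>R ?g)
      \<le> f y + ?g \<bullet> (- (1 / L) *\<^sub>R ?g) + L / 2 * (norm ((1 / L) *\<^sub>R ?g))\<^sup>2"
    using assms(2)[unfolded L_smooth_def, rule_format, of "y - (1 / L) *\<^sub>R ?g" y] by simp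
  also have "\<dots> = f y - 1 / (2 * L) * (norm ?g)\<^sup>2"
    unfolding power2_norm_eq_inner using assms(1) by (simp add: field_simps)
  finally show ?thesis .
qed

lemma suesa_gap_contraction:
  assumes "0 < \<mu>" "\<mu> \<le> L" "L_smooth L f"
  shows "f (suesa_x L f x0 (Suc k)) - min_value (suesa_phi \<mu> L f x0 (Suc k))
    \<le> (1 - \<mu> / L) * (f (suesa_x L f x0 k) - min_value (suesa_phi \<mu> L f x0 k))"
proof -
  let ?y = "suesa_x L f x0 k" and ?p = "suesa_phi \<mu> L f x0 k" and ?a = "\<mu> / L"
  have step: "suesa_phi \<mu> L f x0 (Suc k) = (\<lambda>x. (1 - ?a) * ?p x + ?a * lower_model \<mu> f ?y x)"
    by (simp add: suesa_alpha_def suesa_y_def)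
  have attained: "attains_min (suesa_phi \<mu> L f x0 j)" for j
    using assms(1) by (intro attains_min_suesa_phi) simp
  have "attains_min (lower_model \<mu> f ?y)"
    unfolding lower_model_def[abs_def] using assms(1) by (intro quadratic_attains_min) simp
  then have "(1 - ?a) * min_value ?p + ?a * min_value (lower_model \<mu> f ?y)
      \<le> min_value (suesa_phi \<mu> L f x0 (Suc k))"
    unfolding step using assms attained[of k] attained[of "Suc k", unfolded step]
    by (intro min_value_convex_combination) auto
  moreover have "?a * min_value (lower_model \<mu> f ?y)
      = ?a * f ?y - 1 / (2 * L) * (norm (grad f ?y))\<^sup>2"
    using assms by (simp add: min_value_lower_model field_simps)
  moreover have "f (suesa_x L f x0 (Suc k)) \<le> f ?y - 1 / (2 * L) * (norm (grad f ?y))\<^sup>2"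
    using gradient_step_descent[of L f ?y] assms by simp
  ultimately show ?thesis
    by (simp only: right_diff_distrib left_diff_distrib mult_1_left)
qed

theorem corollary3:
  fixes f :: "real ^ 'n \<Rightarrow> real" and \<mu> L :: real and x0 :: "real ^ 'n"
  assumes "0 < \<mu>" and "\<mu> < L"
    and "continuously_differentiable f"
    and "strongly_convex \<mu> f"
    and "L_smooth L f"
  shows "underestimate_sequence f (suesa_x L f x0) (suesa_phi \<mu> L f x0) (suesa_alpha \<mu> L)
    \<and> (\<forall>k. f (suesa_x L f x0 k) - min_value (suesa_phi \<mu> L f x0 k)
           \<le> (1 - \<mu> / L) ^ k * (f x0 - min_value (suesa_phi \<mu> L f x0 0)))"
proof -
  have contraction: "f (suesa_x L f x0 (Suc k)) - min_value (suesa_phi \<mu> L f x0 (Suc k))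
    \<le> (1 - \<mu> / L) * (f (suesa_x L f x0 k) - min_value (suesa_phi \<mu> L f x0 k))" for k
    using assms by (intro suesa_gap_contraction) auto
  have "underestimate_sequence f (suesa_x L f x0) (suesa_phi \<mu> L f x0) (suesa_alpha \<mu> L)"
    unfolding underestimate_sequence_def
    using assms contraction attains_min_suesa_phi[of \<mu> L f x0] suesa_phi_le[of \<mu> L f x0]
    by (simp add: suesa_alpha_def del: suesa_phi.simps suesa_x.simps)
  moreover have "f (suesa_x L f x0 k) - min_value (suesa_phi \<mu> L f x0 k)
    \<le> (1 - \<mu> / L) ^ k * (f x0 - min_value (suesa_phi \<mu> L f x0 0))" for k
  proof (induction k)
    case 0
    show ?case by simp
  next
    case (Suc k)
    have "0 \<le> 1 - \<mu> / L" using assms by simp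
    from order_trans[OF contraction mult_left_mono[OF Suc this]]
    show ?case by (simp only: power_Suc mult.assoc)
  qed
  ultimately show ?thesis by blast
qed

end
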